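(* Let $d\ge 1$ be an integer. For each $n\ge 1$ let $y$ be a partial automorphism of the $n$-level $d$-regular rooted tree chosen uniformly at random from the finite set $\mathcal{P}_n$ of all such partial automorphisms, let $A_y$ be its action matrix on the $n$th level, and let $\Xi_n=\frac{1}{d^n}\sum_{k=1}^{d^n}\delta_{\lambda_k}$ be the uniform distribution on the eigenvalues $\lambda_1,\dots,\lambda_{d^n}$ of $A_y$, counted with multiplicity. Then for any continuous function $f\in C(D)$, where $D=\{z\in\mathbb{C}\mid |z|\le 1\}$ is the unit disc, $$\int_D f(x)\,\Xi_n(dx)\longrightarrow f(0)\quad\text{in probability as } n\to\infty .$$ In other words, $\Xi_n$ converges weakly in probability to $\delta_0$ as $n\to\infty$, where $\delta_0$ is the delta-measure concentrated at $0$.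
   Context: The $n$-level $d$-regular rooted tree $T$ is the rooted tree with levels $0,1,\dots,n$ (the root is the only vertex of level $0$) in which every vertex of level less than $n$ has exactly $d$ children and the vertices of level $n$ have none. Its $n$th level $B_n=\{v_i^n\mid i=1,\dots,d^n\}$ has $d^n$ vertices, enumerated in a fixed way. A partial automorphism of $T$ is a root-preserving tree isomorphism $y:T_1\to T_2$ between connected subtrees $T_1,T_2$ of $T$, both containing the root; $\operatorname{dom}(y)=T_1$. The set of all partial automorphisms of $T$ is a finite semigroup under composition of partial maps. It is isomorphic to, and identified with, the $n$th partial wreath power $\mathcal{P}_n$ of the symmetric inverse semigroup $\mathcal{I}_d$ (all partial bijections of $\{1,\dots,d\}$, including the empty one), so $\mathcal{P}_n$ here denotes the set of all partial automorphisms of $T$. For $y\in\mathcal{P}_n$, the action matrix is the $d^n\times d^n$ matrix $A_y=\left(\mathbf{1}_{\{y(v_i^n)=v_j^n\}}\right)_{i,j=1}^{d^n}$, i.e. the $(i,j)$ entry is $1$ if $v_i^n\in\operatorname{dom}(y)$ and $y(v_i^n)=v_j^n$, and $0$ otherwise. The numbers $\lambda_1,\dots,\lambda_{d^n}$ are the roots of the characteristic polynomial of $A_y$, respecting multiplicity; they all lie in $D$. $\delta_\lambda$ is the unit point mass at $\lambda$. Convergence in probability means that for every $\varepsilon>0$, $\mathbb{P}\left(\left|\int_D f\,d\Xi_n-f(0)\right|>\varepsilon\right)\to 0$ as $n\to\infty$. *)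

theory Defs
  imports
    "HOL-Probability.Probability"
    "HOL-Computational_Algebra.Computational_Algebra"
    "Graph_Theory.Digraph_Component"
    "Jordan_Normal_Form.Char_Poly"
begin

text \<open>
  A vertex of level \<open>k\<close> is the word of length \<open>k\<close> over \<open>{0..<d}\<close> that spells the path from the
  root \<open>[]\<close> to it; the children of \<open>u\<close> are the words \<open>u @ [i]\<close>. The tree is an undirected graph,
  so each edge gives a pair of opposite arcs.
\<close>

definition regular_tree :: "nat \<Rightarrow> nat \<Rightarrow> nat list pair_pre_digraph" where
  "regular_tree d n =
    (let V = {w. set w \<subseteq> {0..<d} \<and> length w \<le> n}
     in \<lparr>pverts = V, parcs = {(u, w). u \<in> V \<and> w \<in> V \<and> (\<exists>i. w = u @ [i] \<or> u = w @ [i])}\<rparr>)"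

definition bottom_level :: "nat \<Rightarrow> nat \<Rightarrow> nat list set" where
  "bottom_level d n = {w \<in> pverts (regular_tree d n). length w = n}"

text \<open>A connected subgraph of a tree is automatically induced; taking induced subgraphs from the
  start keeps both orientations of every edge.\<close>

definition rooted_subtree :: "nat \<Rightarrow> nat \<Rightarrow> nat list pair_pre_digraph \<Rightarrow> bool" where
  "rooted_subtree d n H \<longleftrightarrow>
     induced_subgraph (with_proj H) (with_proj (regular_tree d n)) \<and>
     Digraph_Component.connected (with_proj H) \<and> [] \<in> pverts H"

definition partial_automorphism :: "nat \<Rightarrow> nat \<Rightarrow> (nat list \<rightharpoonup> nat list) \<Rightarrow> bool" where
  "partial_automorphism d n y \<longleftrightarrow>
     (\<exists>H K. rooted_subtree d n H \<and> rooted_subtree d n K \<and>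
        dom y = pverts H \<and> bij_betw (\<lambda>u. the (y u)) (pverts H) (pverts K) \<and>
        y [] = Some [] \<and>
        (\<forall>u\<in>pverts H. \<forall>w\<in>pverts H.
           (u, w) \<in> parcs H \<longleftrightarrow> (the (y u), the (y w)) \<in> parcs K))"

definition partial_automorphisms :: "nat \<Rightarrow> nat \<Rightarrow> (nat list \<rightharpoonup> nat list) set" where
  "partial_automorphisms d n = {y. partial_automorphism d n y}"

text \<open>Here \<open>v\<close> is an enumeration of the bottom level by \<open>{0..<d ^ n}\<close>: matrix indices start at 0.\<close>

definition action_matrix ::
    "nat \<Rightarrow> nat \<Rightarrow> (nat \<Rightarrow> nat list) \<Rightarrow> (nat list \<rightharpoonup> nat list) \<Rightarrow> complex mat" where
  "action_matrix d n v y =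
     mat (d ^ n) (d ^ n) (\<lambda>(i, j). if y (v i) = Some (v j) then 1 else 0)"

definition eigenvalue_distribution ::
    "nat \<Rightarrow> nat \<Rightarrow> (nat \<Rightarrow> nat list) \<Rightarrow> (nat list \<rightharpoonup> nat list) \<Rightarrow> complex pmf" where
  "eigenvalue_distribution d n v y = pmf_of_multiset (proots (char_poly (action_matrix d n v y)))"

text \<open>The normalising constant is \<open>1 / d ^ n\<close>, and \<open>pmf_of_multiset\<close> and \<open>pmf_of_set\<close> are used
  within their intended domain:\<close>

lemma size_eigenvalues: "size (proots (char_poly (action_matrix d n v y))) = d ^ n"
proof -
  have "action_matrix d n v y \<in> carrier_mat (d ^ n) (d ^ n)"
    by (simp add: action_matrix_def)
  from degree_monic_char_poly[OF this] show ?thesis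
    by (metis size_proots_complex)
qed

lemma pmf_eigenvalue_distribution:
  assumes "d \<ge> 1"
  shows "pmf (eigenvalue_distribution d n v y) x =
           real (count (proots (char_poly (action_matrix d n v y))) x) / real (d ^ n)"
proof -
  have "proots (char_poly (action_matrix d n v y)) \<noteq> {#}"
    using size_eigenvalues[of d n v y] assms by auto
  then show ?thesis
    by (simp add: eigenvalue_distribution_def size_eigenvalues)
qed

lemma finite_partial_automorphisms: "finite (partial_automorphisms d n)"
proof -
  let ?V = "pverts (regular_tree d n)"
  have fin: "finite ?V"
    by (simp add: regular_tree_def Let_def finite_lists_length_le)
  have sub: "pverts H \<subseteq> ?V" if "rooted_subtree d n H" for H
    using that by (auto simp: rooted_subtree_def induced_subgraph_def subgraph_def)
  have "partial_automorphisms d n \<subseteq> (\<Union>A\<in>Pow ?V. {y. dom y = A \<and> ran y \<subseteq> ?V})"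
  proof
    fix y assume "y \<in> partial_automorphisms d n"
    then obtain H K where HK: "rooted_subtree d n H" "rooted_subtree d n K" "dom y = pverts H"
      "bij_betw (\<lambda>u. the (y u)) (pverts H) (pverts K)"
      by (auto simp: partial_automorphisms_def partial_automorphism_def)
    have "ran y \<subseteq> pverts K"
    proof
      fix b assume "b \<in> ran y"
      then obtain a where a: "y a = Some b" by (auto simp: ran_def)
      then have "a \<in> pverts H" using HK(3) by auto
      with HK(4) a show "b \<in> pverts K" by (force simp: bij_betw_def)
    qed
    then show "y \<in> (\<Union>A\<in>Pow ?V. {y. dom y = A \<and> ran y \<subseteq> ?V})"
      using sub[OF HK(1)] sub[OF HK(2)] HK(3) by auto
  qed
  moreover have "finite (\<Union>A\<in>Pow ?V. {y. dom y = A \<and> ran y \<subseteq> ?V})"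
    using fin by (auto intro!: finite_set_of_finite_maps intro: finite_subset)
  ultimately show ?thesis by (rule finite_subset)
qed

lemma partial_automorphisms_nonempty: "partial_automorphisms d n \<noteq> {}"
proof -
  let ?H = "\<lparr>pverts = {[]}, parcs = {}\<rparr> :: nat list pair_pre_digraph"
  have wf: "wf_digraph (with_proj (regular_tree d n))" "wf_digraph (with_proj ?H)"
    by (unfold_locales, auto simp: regular_tree_def Let_def)+
  have "induced_subgraph (with_proj ?H) (with_proj (regular_tree d n))"
    using wf by (auto simp: induced_subgraph_def subgraph_def compatible_def)
      (auto simp: regular_tree_def Let_def)
  moreover have "Digraph_Component.connected (with_proj ?H)"
    by (auto simp: Digraph_Component.connected_def strongly_connected_def reachable_def
        intro: rtrancl_on.intros)
  ultimately have "rooted_subtree d n ?H"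
    by (simp add: rooted_subtree_def)
  then have "partial_automorphism d n [[] \<mapsto> []]"
    unfolding partial_automorphism_def
    by (intro exI[of _ ?H]) (auto simp: bij_betw_def)
  then show ?thesis
    by (auto simp: partial_automorphisms_def)
qed

end

theory Submission
  imports Defs "HOL-Combinatorics.Cycles"
begin

text \<open>
  The eigenvalue distribution has mass at most \<open>c / d ^ n\<close> away from \<open>0\<close>, where \<open>c\<close> is the number of
  cyclic points of \<open>y\<close> on the bottom level, that is, of vertices to which some positive power of \<open>y\<close>
  returns. Indeed a partial injection acts nilpotently off its cycles, which shows in the permutation
  expansion of the characteristic polynomial (\<open>monom_dvd_char_poly\<close>). The integral of \<open>f\<close> thus
  differs from \<open>f 0\<close> by at most a constant times \<open>c / d ^ n\<close>, and by Markov's inequality it is enough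
  that a fixed bottom vertex \<open>x\<close> is cyclic with a probability that tends to \<open>0\<close>, uniformly in \<open>x\<close>
  (\<open>cyclic_point_probability_vanishes\<close>).

  Let \<open>d \<ge> 2\<close> and follow the periods of the prefixes of a cyclic \<open>x\<close> from the root to the bottom. They
  never decrease, and at each level the period stays the same with conditional probability at most
  one half: composing \<open>y\<close> with the exchange of two sibling subtrees destroys the equality
  (\<open>period_preserved_at_child\<close>). Hence for fixed \<open>L\<close> the parent of \<open>x\<close> has period at most \<open>L\<close> only with
  probability at most \<open>4 ^ L * (3 / 4) ^ (n - 1)\<close> (\<open>short_period_rare\<close>). If the period exceeds
  \<open>L\<close>, then \<open>x\<close> is cyclic only if none of more than \<open>L\<close> vertices on the last level but one has lost all
  its children, and this has probability at most \<open>(d + 1) ^ d / (L + 1)\<close>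
  (\<open>long_period_cyclic_rare\<close>). Large \<open>L\<close> and then large \<open>n\<close> make both small.

  All probabilities are uniform, so these bounds are statements about cardinalities and are
  proved by explicit injections. For \<open>d = 1\<close> only one of the \<open>n + 1\<close> partial automorphisms
  reaches the bottom level at all.
\<close>

section \<open>Partial automorphisms as maps on words\<close>

abbreviation tree_words :: "nat \<Rightarrow> nat \<Rightarrow> nat list set" where
  "tree_words d n \<equiv> pverts (regular_tree d n)"

definition word_adjacent :: "nat list \<Rightarrow> nat list \<Rightarrow> bool" where
  "word_adjacent u w \<longleftrightarrow> (\<exists>i. w = u @ [i] \<or> u = w @ [i])"

lemma mem_tree_words: "w \<in> tree_words d n \<longleftrightarrow> set w \<subseteq> {0..<d} \<and> length w \<le> n"
  by (simp add: regular_tree_def Let_def)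

lemma parcs_regular_tree:
  "parcs (regular_tree d n) =
     {(u, w). u \<in> tree_words d n \<and> w \<in> tree_words d n \<and> word_adjacent u w}"
  by (simp add: regular_tree_def Let_def word_adjacent_def)

text \<open>
  Along a walk from the root inside the subtree each step adds or deletes one letter, so the property
  that all prefixes of the current word belong to the subtree is never lost.
\<close>

lemma rooted_subtree_closed_under_parents:
  assumes "rooted_subtree d n H" "u @ [i] \<in> pverts H"
  shows "u \<in> pverts H"
proof -
  have arcs: "(a, b) \<in> parcs H \<Longrightarrow> word_adjacent a b" for a b
    using assms(1)
    by (auto simp: rooted_subtree_def induced_subgraph_def parcs_regular_tree)
  have "[] \<rightarrow>\<^sup>*\<^bsub>with_proj (mk_symmetric (with_proj H))\<^esub> (u @ [i])"
    using assms unfolding rooted_subtree_def Digraph_Component.connected_def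
      strongly_connected_def by simp
  then have "([], u @ [i]) \<in> rtrancl_on (pverts H) (parcs (mk_symmetric (with_proj H)))"
    by (simp add: reachable_def)
  then have "\<forall>j\<le>length (u @ [i]). take j (u @ [i]) \<in> pverts H"
  proof (induction rule: rtrancl_on_induct)
    case base
    then show ?case by simp
  next
    case (step y z)
    have "word_adjacent y z"
      using step(2) arcs by (fastforce simp: parcs_mk_symmetric word_adjacent_def)
    then show ?case
      using step(4,5) by (force simp: word_adjacent_def le_Suc_eq)
  qed
  then show ?thesis by (auto dest: spec[of _ "length u"])
qed

lemma rooted_subtree_iff:
  "rooted_subtree d n H \<longleftrightarrow>
     [] \<in> pverts H \<and> pverts H \<subseteq> tree_words d n \<and>
     (\<forall>u i. u @ [i] \<in> pverts H \<longrightarrow> u \<in> pverts H) \<and>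
     parcs H = {(u, w). u \<in> pverts H \<and> w \<in> pverts H \<and> word_adjacent u w}"
  (is "?L \<longleftrightarrow> ?R")
proof
  assume L: ?L
  then have "[] \<in> pverts H" "pverts H \<subseteq> tree_words d n"
    "parcs H = {(u, w). u \<in> pverts H \<and> w \<in> pverts H \<and> word_adjacent u w}"
    by (auto simp: rooted_subtree_def induced_subgraph_def subgraph_def parcs_regular_tree)
  then show ?R using rooted_subtree_closed_under_parents[OF L] by blast
next
  assume R: ?R
  then have root: "[] \<in> pverts H" and sub: "pverts H \<subseteq> tree_words d n"
    and parent: "\<And>u i. u @ [i] \<in> pverts H \<Longrightarrow> u \<in> pverts H"
    and arcs: "parcs H = {(u, w). u \<in> pverts H \<and> w \<in> pverts H \<and> word_adjacent u w}"
    by blast+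
  have wf: "wf_digraph (with_proj (regular_tree d n))" "wf_digraph (with_proj H)"
    by (unfold_locales, auto simp: parcs_regular_tree arcs)
  have ind: "induced_subgraph (with_proj H) (with_proj (regular_tree d n))"
    using wf sub by (auto simp: induced_subgraph_def subgraph_def compatible_def parcs_regular_tree arcs)
  define M where "M = parcs (mk_symmetric (with_proj H))"
  have M: "(a, b) \<in> M \<longleftrightarrow> a \<in> pverts H \<and> b \<in> pverts H \<and> word_adjacent a b" for a b
    unfolding M_def parcs_mk_symmetric by (force simp: arcs word_adjacent_def)
  have to_root: "(w, []) \<in> rtrancl_on (pverts H) M \<and> ([], w) \<in> rtrancl_on (pverts H) M"
    if "w \<in> pverts H" for w
    using that
  proof (induction w rule: rev_induct)
    case Nil
    then show ?case by simp
  next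
    case (snoc i w)
    then have w: "w \<in> pverts H" using parent by blast
    have "(w, w @ [i]) \<in> M" "(w @ [i], w) \<in> M"
      using w snoc(2) by (auto simp: M word_adjacent_def)
    then show ?case
      using snoc w
      by (meson converse_rtrancl_on_into_rtrancl_on rtrancl_on_into_rtrancl_on)
  qed
  have "Digraph_Component.connected (with_proj H)"
    unfolding Digraph_Component.connected_def strongly_connected_def reachable_def
    using root to_root by (auto simp: M_def[symmetric] intro: rtrancl_on_trans)
  then show ?L using ind root by (simp add: rooted_subtree_def)
qed

text \<open>
  Adjacency alone lets the image of a child be the parent of the image of \<open>u\<close>. By induction that
  parent is the image of the parent of \<open>u\<close>, so injectivity excludes it.
\<close>

lemma partial_automorphism_preserves_parents:
  assumes "y \<in> partial_automorphisms d n" "y (u @ [i]) = Some w"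
  shows "\<exists>u' j. y u = Some u' \<and> w = u' @ [j]"
proof -
  obtain H K where H: "rooted_subtree d n H" and K: "rooted_subtree d n K"
    and dom: "dom y = pverts H"
    and bij: "bij_betw (\<lambda>u. the (y u)) (pverts H) (pverts K)" and root: "y [] = Some []"
    and arcs: "\<And>u w. u \<in> pverts H \<Longrightarrow> w \<in> pverts H \<Longrightarrow>
      (u, w) \<in> parcs H \<longleftrightarrow> (the (y u), the (y w)) \<in> parcs K"
    using assms(1) unfolding partial_automorphisms_def partial_automorphism_def by auto
  note parent = rooted_subtree_closed_under_parents[OF H]
  have adj: "word_adjacent (the (y a)) (the (y (a @ [k])))" if "a @ [k] \<in> pverts H" for a k
    using that parent[OF that] arcs[of a "a @ [k]"] H K
    by (auto simp: rooted_subtree_iff word_adjacent_def)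
  have "\<exists>j. the (y (u @ [i])) = the (y u) @ [j]" if "u @ [i] \<in> pverts H" for u i
    using that
  proof (induction u arbitrary: i rule: rev_induct)
    case Nil
    then show ?case using adj[of "[]" i] root by (auto simp: word_adjacent_def)
  next
    case (snoc k u)
    note uki = snoc.prems
    have uk: "u @ [k] \<in> pverts H" using parent uki by blast
    have u: "u \<in> pverts H" using parent uk by blast
    obtain l where l: "the (y (u @ [k])) = the (y u) @ [l]" using snoc.IH uk by blast
    show ?case
    proof (rule ccontr)
      assume "\<not> ?case"
      then have "the (y u) = the (y ((u @ [k]) @ [i]))"
        using adj[OF uki] l by (auto simp: word_adjacent_def)
      then have "u = (u @ [k]) @ [i]"
        using bij u uki by (meson bij_betw_def inj_on_def)
      then show False by simp
    qed
  qed
  moreover have ui: "u @ [i] \<in> pverts H" using assms(2) dom by blast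
  ultimately obtain j where "w = the (y u) @ [j]" using assms(2) by fastforce
  moreover have "u \<in> dom y" using parent ui dom by blast
  ultimately show ?thesis by auto
qed

text \<open>
  This word description replaces the graph-theoretic definition from here on: every construction
  below that modifies a partial automorphism is shown to stay in the set by checking it. In the
  converse direction arcs of the image come from arcs of the domain: if \<open>w\<close> is sent to a child of
  the image of \<open>u\<close>, then the parent of \<open>w\<close> has the same image as \<open>u\<close>, so by injectivity it is \<open>u\<close>.
\<close>

lemma partial_automorphism_iff:
  "y \<in> partial_automorphisms d n \<longleftrightarrow>
     y [] = Some [] \<and> dom y \<subseteq> tree_words d n \<and> ran y \<subseteq> tree_words d n \<and> inj_on y (dom y) \<and>
     (\<forall>u i w. y (u @ [i]) = Some w \<longrightarrow> (\<exists>u' j. y u = Some u' \<and> w = u' @ [j]))"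
  (is "?L \<longleftrightarrow> ?R")
proof
  assume L: ?L
  then obtain H K where H: "rooted_subtree d n H" and K: "rooted_subtree d n K"
    and dom: "dom y = pverts H"
    and bij: "bij_betw (\<lambda>u. the (y u)) (pverts H) (pverts K)" and root: "y [] = Some []"
    unfolding partial_automorphisms_def partial_automorphism_def by auto
  have "ran y \<subseteq> pverts K"
  proof
    fix b assume "b \<in> ran y"
    then obtain a where a: "y a = Some b" by (auto simp: ran_def)
    then have "a \<in> pverts H" using dom by auto
    with bij a show "b \<in> pverts K" by (force simp: bij_betw_def)
  qed
  moreover have "inj_on y (dom y)"
    using bij unfolding dom bij_betw_def inj_on_def by metis
  ultimately show ?R
    using H K dom root partial_automorphism_preserves_parents[OF L]
    unfolding rooted_subtree_iff by blast
next
  assume R: ?R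
  then have root: "y [] = Some []" and dom: "dom y \<subseteq> tree_words d n"
    and ran: "ran y \<subseteq> tree_words d n" and inj: "inj_on y (dom y)"
    and par: "\<And>u i w. y (u @ [i]) = Some w \<Longrightarrow> \<exists>u' j. y u = Some u' \<and> w = u' @ [j]"
    by blast+
  have injD: "a = b" if "y a = Some c" "y b = Some c" for a b c
    using inj that by (metis domI inj_on_def)
  have child: "u @ [i] \<in> dom y \<Longrightarrow> u \<in> dom y" for u i
    using par by blast
  have par': "\<exists>u0 k. w = u0 @ [k] \<and> y u0 = Some u'" if w: "y w = Some (u' @ [j])" for w u' j
  proof (cases w rule: rev_cases)
    case Nil
    then show ?thesis using w root by simp
  next
    case (snoc u0 k)
    then show ?thesis using par[of u0 k] w by auto
  qed
  define H :: "nat list pair_pre_digraph" where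
    "H = \<lparr>pverts = dom y, parcs = {(u, w). u \<in> dom y \<and> w \<in> dom y \<and> word_adjacent u w}\<rparr>"
  define K :: "nat list pair_pre_digraph" where
    "K = \<lparr>pverts = ran y, parcs = {(u, w). u \<in> ran y \<and> w \<in> ran y \<and> word_adjacent u w}\<rparr>"
  have "rooted_subtree d n H"
    unfolding rooted_subtree_iff H_def using root dom child by auto
  moreover have "u \<in> ran y" if "u @ [i] \<in> ran y" for u i
    using that par' unfolding ran_def by blast
  then have "rooted_subtree d n K"
    unfolding rooted_subtree_iff K_def using root ran by (auto intro: ranI)
  moreover have "bij_betw (\<lambda>u. the (y u)) (pverts H) (pverts K)"
    unfolding bij_betw_def inj_on_def H_def K_def
    using injD by (auto simp: ran_def image_iff) (metis option.sel domI)
  moreover have "word_adjacent u w \<longleftrightarrow> word_adjacent a b" if "y u = Some a" "y w = Some b" for u w a b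
  proof
    assume "word_adjacent u w"
    then show "word_adjacent a b"
      using that par unfolding word_adjacent_def by fastforce
  next
    assume "word_adjacent a b"
    then show "word_adjacent u w"
      using that par' injD unfolding word_adjacent_def by metis
  qed
  then have "\<forall>u\<in>pverts H. \<forall>w\<in>pverts H.
      (u, w) \<in> parcs H \<longleftrightarrow> (the (y u), the (y w)) \<in> parcs K"
    by (auto simp: H_def K_def intro: ranI)
  ultimately have "partial_automorphism d n y"
    unfolding partial_automorphism_def using root
    by (intro exI[of _ H] exI[of _ K]) (auto simp: H_def)
  then show ?L by (simp add: partial_automorphisms_def)
qed

lemma partial_automorphism_injD:
  assumes "y \<in> partial_automorphisms d n" "y a = Some c" "y b = Some c"
  shows "a = b"
  using assms unfolding partial_automorphism_iff by (metis domI inj_on_def)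

lemma partial_automorphism_length:
  assumes "y \<in> partial_automorphisms d n" "y w = Some w'"
  shows "length w' = length w"
  using assms(2)
proof (induction w arbitrary: w' rule: rev_induct)
  case Nil
  then show ?case using assms(1) by (simp add: partial_automorphism_iff)
next
  case (snoc i w)
  obtain u k where "y w = Some u" "w' = u @ [k]"
    using partial_automorphism_preserves_parents[OF assms(1) snoc.prems] by blast
  then show ?case using snoc.IH by simp
qed

lemma partial_automorphism_take:
  assumes "y \<in> partial_automorphisms d n" "y w = Some w'"
  shows "y (take j w) = Some (take j w')"
  using assms(2)
proof (induction w arbitrary: w' rule: rev_induct)
  case Nil
  then show ?case using assms(1) by (auto simp: partial_automorphism_iff)
next
  case (snoc i w)
  obtain u k where u: "y w = Some u" "w' = u @ [k]"
    using partial_automorphism_preserves_parents[OF assms(1) snoc.prems] by blast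
  have "length u = length w" using partial_automorphism_length[OF assms(1) u(1)] .
  then show ?case using snoc u by (cases "j \<le> length w") auto
qed

lemma partial_automorphism_domD:
  assumes "y \<in> partial_automorphisms d n" "y w = Some w'"
  shows "w \<in> tree_words d n" "w' \<in> tree_words d n"
  using assms unfolding partial_automorphism_iff by (auto simp: ran_def)

section \<open>Orbits of partial maps\<close>

primrec iterate :: "nat \<Rightarrow> ('a \<rightharpoonup> 'a) \<Rightarrow> 'a \<rightharpoonup> 'a" where
  "iterate 0 y w = Some w"
| "iterate (Suc m) y w = Option.bind (iterate m y w) y"

definition cyclic_point :: "('a \<rightharpoonup> 'a) \<Rightarrow> 'a \<Rightarrow> bool" where
  "cyclic_point y w \<longleftrightarrow> (\<exists>p\<ge>1. iterate p y w = Some w)"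

definition returns_within :: "nat \<Rightarrow> ('a \<rightharpoonup> 'a) \<Rightarrow> 'a \<Rightarrow> bool" where
  "returns_within L y w \<longleftrightarrow> (\<exists>p\<in>{1..L}. iterate p y w = Some w)"

lemma iterate_add: "iterate (m + k) y w = Option.bind (iterate m y w) (iterate k y)"
  by (induction k) (auto simp: bind_assoc split: bind_splits)

lemma iterate_defined_mono:
  assumes "iterate k y w \<noteq> None" "m \<le> k"
  shows "iterate m y w \<noteq> None"
  using assms iterate_add[of m "k - m" y w] by (cases "iterate m y w") auto

lemma iterate_mult:
  assumes "iterate p y w = Some w"
  shows "iterate (p * q) y w = Some w"
  using assms by (induction q) (auto simp: iterate_add)

lemma cyclic_point_iterate_defined:
  assumes "cyclic_point y w"
  obtains w' where "iterate m y w = Some w'"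
proof -
  obtain p where p: "p \<ge> 1" "iterate p y w = Some w"
    using assms by (auto simp: cyclic_point_def)
  have "m \<le> p * m" using p(1) by simp
  then have "iterate m y w \<noteq> None"
    using iterate_defined_mono iterate_mult[OF p(2), of m] by (metis option.distinct(1))
  then show ?thesis using that by blast
qed

lemma iterate_take:
  assumes "y \<in> partial_automorphisms d n" "iterate m y w = Some w'"
  shows "iterate m y (take j w) = Some (take j w')"
  using assms(2)
proof (induction m arbitrary: w')
  case (Suc m)
  then obtain v where v: "iterate m y w = Some v" "y v = Some w'"
    by (auto simp: bind_eq_Some_conv)
  show ?case using Suc.IH[OF v(1)] partial_automorphism_take[OF assms(1) v(2)] by simp
qed simp

lemma iterate_length:
  assumes "y \<in> partial_automorphisms d n" "iterate m y w = Some w'"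
  shows "length w' = length w"
  using assms(2)
  by (induction m arbitrary: w')
    (auto simp: bind_eq_Some_conv dest!: partial_automorphism_length[OF assms(1)])

lemma iterate_inj:
  assumes "y \<in> partial_automorphisms d n" "iterate m y a = Some c" "iterate m y b = Some c"
  shows "a = b"
  using assms(2,3)
proof (induction m arbitrary: c)
  case (Suc m)
  then obtain a' b' where "iterate m y a = Some a'" "y a' = Some c"
    "iterate m y b = Some b'" "y b' = Some c"
    by (auto simp: bind_eq_Some_conv)
  then show ?case using Suc.IH partial_automorphism_injD[OF assms(1)] by metis
qed simp

text \<open>
  A partial injection can only revisit a point of the orbit of \<open>u\<close> after having returned to \<open>u\<close>
  itself, so an orbit without a return up to time \<open>L\<close> has \<open>L + 1\<close> different points whenever it is
  defined that long.
\<close>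

lemma iterates_distinct:
  assumes y: "y \<in> partial_automorphisms d n" and ret: "\<not> returns_within L y u"
    and "i \<le> L" "k \<le> L" "iterate i y u = Some c" "iterate k y u = Some c"
  shows "i = k"
proof -
  have *: "i = k" if ik: "i \<le> k" "k \<le> L" "iterate i y u = Some c" "iterate k y u = Some c" for i k
  proof -
    have "iterate ((k - i) + i) y u = Some c" using ik by simp
    then obtain e where e: "iterate (k - i) y u = Some e" "iterate i y e = Some c"
      unfolding iterate_add by (auto simp: bind_eq_Some_conv)
    have "e = u" using iterate_inj[OF y e(2) ik(3)] .
    then have "k - i \<notin> {1..L}" using ret e(1) by (auto simp: returns_within_def)
    then show ?thesis using ik by auto
  qed
  show ?thesis
    using *[of i k] *[of k i] assms(3-6) by (cases "i \<le> k") auto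
qed

section \<open>Short periods are rare\<close>

text \<open>
  The automorphism of the whole tree that exchanges the subtrees below \<open>u @ [a]\<close> and \<open>u @ [b]\<close> and
  fixes everything else.
\<close>

definition swap_children :: "nat list \<Rightarrow> nat \<Rightarrow> nat \<Rightarrow> nat list \<Rightarrow> nat list" where
  "swap_children u a b w =
     (if take (length u) w = u \<and> length u < length w
      then w[length u := Transposition.transpose a b (w ! length u)] else w)"

lemma length_swap_children [simp]: "length (swap_children u a b w) = length w"
  by (simp add: swap_children_def)

lemma take_swap_children [simp]: "take (length u) (swap_children u a b w) = take (length u) w"
  by (simp add: swap_children_def)

lemma swap_children_short: "length w \<le> length u \<Longrightarrow> swap_children u a b w = w"
  by (simp add: swap_children_def)

lemma swap_children_elsewhere: "take (length u) w \<noteq> u \<Longrightarrow> swap_children u a b w = w"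
  by (simp add: swap_children_def)

lemma swap_children_swaps: "swap_children u a b (u @ [a]) = u @ [b]"
  by (simp add: swap_children_def)

lemma swap_children_involutive [simp]: "swap_children u a b (swap_children u a b w) = w"
  by (cases "take (length u) w = u \<and> length u < length w") (auto simp: swap_children_def)

lemma swap_children_eq_iff [simp]: "swap_children u a b v = swap_children u a b w \<longleftrightarrow> v = w"
  by (metis swap_children_involutive)

lemma swap_children_snoc: "\<exists>j. swap_children u a b (w @ [i]) = swap_children u a b w @ [j]"
  by (auto simp: swap_children_def list_update_append nth_append)

lemma swap_children_in_tree:
  assumes "w \<in> tree_words d n" "a < d" "b < d"
  shows "swap_children u a b w \<in> tree_words d n"
proof (cases "take (length u) w = u \<and> length u < length w")
  case True
  have "set (w[length u := Transposition.transpose a b (w ! length u)])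
      \<subseteq> insert (Transposition.transpose a b (w ! length u)) (set w)"
    by (rule set_update_subset_insert)
  moreover have "w ! length u < d"
    using True assms(1) nth_mem by (force simp: mem_tree_words)
  then have "Transposition.transpose a b (w ! length u) < d"
    using assms by (simp add: Transposition.transpose_def)
  ultimately show ?thesis
    using assms(1) True unfolding mem_tree_words by (auto simp: swap_children_def)
qed (use assms in \<open>auto simp: swap_children_def\<close>)

lemma swap_children_partial_automorphism:
  assumes y: "y \<in> partial_automorphisms d n" and "a < d" "b < d"
  shows "(\<lambda>w. map_option (swap_children u a b) (y w)) \<in> partial_automorphisms d n"
    (is "?s \<in> _")
proof -
  have "?s [] = Some []"
    using y by (simp add: partial_automorphism_iff swap_children_short)
  moreover have "dom ?s \<subseteq> tree_words d n"
    using partial_automorphism_domD[OF y] by auto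
  moreover have "ran ?s \<subseteq> tree_words d n"
    using partial_automorphism_domD[OF y] swap_children_in_tree assms(2,3)
    by (auto simp: ran_def)
  moreover have "inj_on ?s (dom ?s)"
    using partial_automorphism_injD[OF y] by (auto simp: inj_on_def)
  moreover have "\<exists>u' j. ?s v = Some u' \<and> w = u' @ [j]" if child: "?s (v @ [i]) = Some w" for v i w
  proof -
    obtain c where c: "y (v @ [i]) = Some c" "w = swap_children u a b c" using child by auto
    then obtain v' k where "y v = Some v'" "c = v' @ [k]"
      using partial_automorphism_preserves_parents[OF y] by blast
    then show ?thesis using c swap_children_snoc by auto
  qed
  ultimately show ?thesis unfolding partial_automorphism_iff by blast
qed

lemma iterate_swap_children_short:
  assumes y: "y \<in> partial_automorphisms d n" and "length w \<le> length u"
  shows "iterate m (\<lambda>w. map_option (swap_children u a b) (y w)) w = iterate m y w"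
proof (induction m)
  case (Suc m)
  show ?case
  proof (cases "iterate m y w")
    case (Some v)
    have "length v \<le> length u" using iterate_length[OF y Some] assms(2) by simp
    then have "map_option (swap_children u a b) (y v) = y v"
      using partial_automorphism_length[OF y] by (cases "y v") (auto simp: swap_children_short)
    then show ?thesis using Some Suc by simp
  qed (use Suc in simp)
qed simp

text \<open>
  The swap acts only below \<open>u\<close>, so an orbit that starts below \<open>u\<close> does not feel it until it comes
  back below \<open>u\<close>.
\<close>

lemma iterate_swap_children_before_return:
  assumes y: "y \<in> partial_automorphisms d n" and m: "m < L"
    and ret: "\<And>p. p \<in> {1..<L} \<Longrightarrow> iterate p y u \<noteq> Some u"
  shows "iterate m (\<lambda>w. map_option (swap_children u a b) (y w)) (u @ v) = iterate m y (u @ v)"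
  using m
proof (induction m)
  case (Suc m)
  show ?case
  proof (cases "iterate (Suc m) y (u @ v)")
    case None
    then show ?thesis using Suc by (auto split: bind_splits)
  next
    case (Some w)
    have "iterate (Suc m) y u = Some (take (length u) w)"
      using iterate_take[OF y Some, of "length u"] by simp
    then have "take (length u) w \<noteq> u" using ret[of "Suc m"] Suc.prems by auto
    then have "swap_children u a b w = w" by (rule swap_children_elsewhere)
    then show ?thesis using Suc Some by (auto simp: bind_eq_Some_conv)
  qed
qed simp

text \<open>
  Let \<open>u\<close> have period \<open>L\<close>. Following \<open>y\<close> by a swap of the children \<open>a\<close> and \<open>b\<close> of \<open>u\<close> leaves the orbit
  of \<open>u\<close> alone, but the \<open>L\<close>-th image of \<open>u @ [a]\<close> changes from \<open>u @ [a]\<close> to \<open>u @ [b]\<close>. So the maps for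
  which the child has the same period as its parent inject into those for which it has not.
\<close>

lemma period_preserved_at_child:
  fixes d n L a :: nat and u :: "nat list"
  defines "B \<equiv> {y \<in> partial_automorphisms d n. iterate L y u = Some u \<and>
                   (\<forall>p\<in>{1..<L}. iterate p y u \<noteq> Some u)}"
    and "F \<equiv> {y \<in> partial_automorphisms d n. iterate L y (u @ [a]) = Some (u @ [a]) \<and>
                   (\<forall>p\<in>{1..<L}. iterate p y u \<noteq> Some u)}"
  assumes d: "d \<ge> 2" and a: "a < d" and L: "L \<ge> 1"
  shows "2 * card F \<le> card B"
proof -
  obtain b where b: "b < d" "b \<noteq> a"
  proof (cases "a = 0")
    case True
    then show ?thesis using that[of 1] d by simp
  next
    case False
    then show ?thesis using that[of 0] d by simp
  qed
  define s where "s = (\<lambda>y w. map_option (swap_children u a b) ((y :: nat list \<rightharpoonup> nat list) w))"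
  have finB: "finite B" unfolding B_def using finite_partial_automorphisms by simp
  have FB: "F \<subseteq> B"
    unfolding F_def B_def using iterate_take[of _ d n L "u @ [a]" "u @ [a]" "length u"] by auto
  have inj: "inj_on s F"
  proof
    fix y y' assume "s y = s y'"
    then have "map_option (swap_children u a b) (y w) = map_option (swap_children u a b) (y' w)" for w
      by (simp add: s_def fun_eq_iff)
    moreover have "inj (map_option (swap_children u a b))"
      by (intro option.inj_map injI) simp
    ultimately have "y w = y' w" for w
      by (blast dest: injD)
    then show "y = y'" by blast
  qed
  have sF: "s ` F \<subseteq> B - F"
  proof
    fix z assume "z \<in> s ` F"
    then obtain y where y: "y \<in> F" "z = s y" by blast
    then have yP: "y \<in> partial_automorphisms d n"
      and ret: "\<And>p. p \<in> {1..<L} \<Longrightarrow> iterate p y u \<noteq> Some u"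
      and cyc: "iterate L y (u @ [a]) = Some (u @ [a])"
      by (auto simp: F_def)
    have zP: "z \<in> partial_automorphisms d n"
      using swap_children_partial_automorphism[OF yP a b(1)] by (simp add: y s_def)
    have "iterate m z u = iterate m y u" for m
      using iterate_swap_children_short[OF yP, of u u] by (simp add: y s_def)
    then have "z \<in> B" using zP y(1) FB by (auto simp: B_def)
    obtain m where m: "L = Suc m" using L by (cases L) auto
    have "iterate m z (u @ [a]) = iterate m y (u @ [a])"
      unfolding y(2) s_def
      by (rule iterate_swap_children_before_return[OF yP, where L = L]) (use m ret in auto)
    then have "iterate L z (u @ [a]) = map_option (swap_children u a b) (iterate L y (u @ [a]))"
      unfolding m by (cases "iterate m y (u @ [a])") (auto simp: y s_def)
    then have "iterate L z (u @ [a]) = Some (u @ [b])"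
      using cyc by (simp add: swap_children_swaps)
    then have "z \<notin> F" using b(2) by (simp add: F_def)
    with \<open>z \<in> B\<close> show "z \<in> B - F" by blast
  qed
  have "2 * card F = card F + card (s ` F)" using card_image[OF inj] by simp
  also have "\<dots> = card (F \<union> s ` F)"
    using sF FB finB by (intro card_Un_disjoint[symmetric]) (auto intro: finite_subset)
  also have "\<dots> \<le> card B" using sF FB finB by (intro card_mono) auto
  finally show ?thesis .
qed

text \<open>
  The period of a vertex is at least that of its parent. A child with period at most \<open>L + 1\<close>
  therefore has a parent with period at most \<open>L\<close>, or both periods equal \<open>L + 1\<close>, which the preceding
  lemma charges with a factor one half.
\<close>

lemma short_period_recurrence:
  assumes d: "d \<ge> 2" and x: "x \<in> bottom_level d n" and j: "j < n"
  shows "real (card {y \<in> partial_automorphisms d n. returns_within (Suc L) y (take (Suc j) x)})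
     \<le> real (card {y \<in> partial_automorphisms d n. returns_within (Suc L) y (take j x)}) / 2
       + real (card {y \<in> partial_automorphisms d n. returns_within L y (take j x)})"
    (is "real (card ?A) \<le> real (card ?B) / 2 + real (card ?C)")
proof -
  let ?P = "partial_automorphisms d n"
  define u a where "u = take j x" and "a = x ! j"
  have x': "length x = n" "set x \<subseteq> {0..<d}"
    using x by (auto simp: bottom_level_def mem_tree_words)
  have a: "a < d" using x' j nth_mem[of j x] by (auto simp: a_def subset_iff)
  have ua: "take (Suc j) x = u @ [a]" using x' j by (simp add: u_def a_def take_Suc_conv_app_nth)
  let ?F = "{y \<in> ?P. iterate (Suc L) y (u @ [a]) = Some (u @ [a]) \<and>
                   (\<forall>p\<in>{1..<Suc L}. iterate p y u \<noteq> Some u)}"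
  let ?G = "{y \<in> ?P. iterate (Suc L) y u = Some u \<and>
                   (\<forall>p\<in>{1..<Suc L}. iterate p y u \<noteq> Some u)}"
  have fin: "finite {y \<in> ?P. Q y}" for Q using finite_partial_automorphisms by simp
  have "?A \<subseteq> ?F \<union> ?C"
  proof
    fix y assume "y \<in> ?A"
    then obtain p where y: "y \<in> ?P" and p: "p \<in> {1..Suc L}" "iterate p y (u @ [a]) = Some (u @ [a])"
      by (auto simp: ua returns_within_def)
    have pu: "iterate p y u = Some u" using iterate_take[OF y p(2), of "length u"] by simp
    show "y \<in> ?F \<union> ?C"
    proof (cases "returns_within L y u")
      case True
      then show ?thesis using y by (simp add: u_def)
    next
      case False
      then have no: "\<forall>q\<in>{1..L}. iterate q y u \<noteq> Some u" by (auto simp: returns_within_def)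
      then have "p = Suc L" using p(1) pu by (auto simp: le_Suc_eq)
      then have "y \<in> ?F" using y p no by (auto simp del: iterate.simps)
      then show ?thesis by blast
    qed
  qed
  then have "card ?A \<le> card (?F \<union> ?C)" using fin by (intro card_mono finite_UnI)
  also have "\<dots> \<le> card ?F + card ?C" by (rule card_Un_le)
  finally have "card ?A \<le> card ?F + card ?C" .
  moreover have "2 * card ?F \<le> card ?G"
    using period_preserved_at_child[OF d a, of "Suc L" n u] by simp
  moreover have "?G \<subseteq> ?B" by (auto simp: returns_within_def u_def simp del: iterate.simps)
  then have "card ?G \<le> card ?B" using fin by (intro card_mono)
  ultimately show ?thesis by linarith
qed

text \<open>
  The bound \<open>4 ^ L * (3 / 4) ^ j\<close> is chosen to solve the recurrence: raising \<open>j\<close> by one costs the factor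
  \<open>1 / 2 + 1 / 4\<close>, where the second summand comes from lowering \<open>L\<close> by one.
\<close>

lemma short_period_rare:
  assumes d: "d \<ge> 2" and x: "x \<in> bottom_level d n" and "j \<le> n"
  shows "real (card {y \<in> partial_automorphisms d n. returns_within L y (take j x)})
     \<le> 4 ^ L * (3 / 4) ^ j * real (card (partial_automorphisms d n))"
  using assms(3)
proof (induction j arbitrary: L)
  case 0
  have "real (card {y \<in> partial_automorphisms d n. returns_within L y (take 0 x)})
      \<le> 1 * real (card (partial_automorphisms d n))"
    using finite_partial_automorphisms by (auto intro!: card_mono)
  also have "\<dots> \<le> 4 ^ L * real (card (partial_automorphisms d n))"
    by (intro mult_right_mono) auto
  finally show ?case by simp
next
  case (Suc j)
  show ?case
  proof (cases L)
    case 0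
    then show ?thesis by (simp add: returns_within_def)
  next
    case L: (Suc K)
    let ?N = "real (card (partial_automorphisms d n))"
    have "real (card {y \<in> partial_automorphisms d n. returns_within (Suc K) y (take (Suc j) x)})
       \<le> real (card {y \<in> partial_automorphisms d n. returns_within (Suc K) y (take j x)}) / 2
         + real (card {y \<in> partial_automorphisms d n. returns_within K y (take j x)})"
      using short_period_recurrence[OF d x] Suc.prems by simp
    also have "\<dots> \<le> (4 ^ Suc K * (3 / 4) ^ j * ?N) / 2 + 4 ^ K * (3 / 4) ^ j * ?N"
      using Suc.IH[of "Suc K"] Suc.IH[of K] Suc.prems by (intro add_mono divide_right_mono) auto
    also have "\<dots> = 4 ^ Suc K * (3 / 4) ^ Suc j * ?N" by simp
    finally show ?thesis by (simp only: L)
  qed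
qed

section \<open>Long cycles rarely extend to the bottom level\<close>

definition remove_children :: "nat list \<Rightarrow> (nat list \<rightharpoonup> nat list) \<Rightarrow> nat list \<rightharpoonup> nat list" where
  "remove_children u y w = (if \<exists>a. w = u @ [a] then None else y w)"

text \<open>
  The words removed are leaves of the tree, since \<open>u\<close> lies one level above the bottom; elsewhere the
  domain would cease to be closed under parents.
\<close>

lemma remove_children_partial_automorphism:
  assumes y: "y \<in> partial_automorphisms d n" and u: "Suc (length u) = n"
  shows "remove_children u y \<in> partial_automorphisms d n" (is "?z \<in> _")
proof -
  have le: "?z w = Some w' \<Longrightarrow> y w = Some w'" for w w'
    by (auto simp: remove_children_def split: if_splits)
  have "?z [] = Some []"
    using y by (simp add: partial_automorphism_iff remove_children_def)
  moreover have "dom ?z \<subseteq> tree_words d n"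
    using partial_automorphism_domD[OF y] le by blast
  moreover have "ran ?z \<subseteq> tree_words d n"
    using partial_automorphism_domD(2)[OF y] le unfolding ran_def by blast
  moreover have "inj_on ?z (dom ?z)"
    unfolding inj_on_def using partial_automorphism_injD[OF y] le by (metis domD)
  moreover have "\<exists>v' j. ?z v = Some v' \<and> w = v' @ [j]" if child: "?z (v @ [i]) = Some w" for v i w
  proof -
    have yw: "y (v @ [i]) = Some w" using le child .
    then have "length v < n"
      using partial_automorphism_domD(1)[OF y] by (force simp: mem_tree_words)
    then have "?z v = y v" using u by (auto simp: remove_children_def)
    then show ?thesis using partial_automorphism_preserves_parents[OF y yw] by simp
  qed
  ultimately show ?thesis unfolding partial_automorphism_iff by blast
qed

lemma iterate_remove_children:
  assumes y: "y \<in> partial_automorphisms d n" and "length w \<le> length u"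
  shows "iterate m (remove_children u y) w = iterate m y w"
proof (induction m)
  case (Suc m)
  show ?case
  proof (cases "iterate m y w")
    case (Some v)
    have "length v \<le> length u" using iterate_length[OF y Some] assms(2) by simp
    then have "remove_children u y v = y v" by (auto simp: remove_children_def)
    then show ?thesis using Some Suc by simp
  qed (use Suc in simp)
qed simp

text \<open>
  Meant for defined iterates only; \<open>the\<close> is harmless on the cyclic points considered below.
\<close>

definition orbit_point :: "('a \<rightharpoonup> 'a) \<Rightarrow> 'a \<Rightarrow> nat \<Rightarrow> 'a" where
  "orbit_point y w m = the (iterate m y w)"

text \<open>
  The part of \<open>y\<close> that \<open>remove_children\<close> erases. The last letters suffice, because the image of \<open>u\<close>
  itself survives the removal.
\<close>

definition child_labels :: "nat \<Rightarrow> (nat list \<rightharpoonup> nat list) \<Rightarrow> nat list \<Rightarrow> nat \<Rightarrow> nat option" where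
  "child_labels d y u = (\<lambda>a\<in>{0..<d}. map_option last (y (u @ [a])))"

lemma child_labels_in_PiE:
  assumes y: "y \<in> partial_automorphisms d n"
  shows "child_labels d y u \<in> {0..<d} \<rightarrow>\<^sub>E insert None (Some ` {0..<d})"
proof -
  have "map_option last (y (u @ [a])) \<in> insert None (Some ` {0..<d})" for a
  proof (cases "y (u @ [a])")
    case (Some w)
    then obtain u' j where "w = u' @ [j]"
      using partial_automorphism_preserves_parents[OF y] by blast
    then show ?thesis
      using Some partial_automorphism_domD(2)[OF y Some] by (simp add: mem_tree_words)
  qed simp
  then show ?thesis unfolding child_labels_def by (intro restrict_PiE_iff[THEN iffD2]) auto
qed

lemma partial_automorphism_eqI:
  assumes y: "y \<in> partial_automorphisms d n" and z: "z \<in> partial_automorphisms d n"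
    and rem: "remove_children u y = remove_children u z"
    and lab: "child_labels d y u = child_labels d z u"
  shows "y = z"
proof
  fix w
  show "y w = z w"
  proof (cases "\<exists>a. w = u @ [a]")
    case False
    then show ?thesis using fun_cong[OF rem, of w] by (simp add: remove_children_def)
  next
    case True
    then obtain a where w: "w = u @ [a]" by blast
    have uu: "y u = z u" using fun_cong[OF rem, of u] by (simp add: remove_children_def)
    show ?thesis
    proof (cases "a < d")
      case False
      then have "w \<notin> tree_words d n" by (auto simp: w mem_tree_words)
      then show ?thesis
        using partial_automorphism_domD(1)[OF y] partial_automorphism_domD(1)[OF z]
        by (metis option.exhaust)
    next
      case True
      then have last: "map_option last (y w) = map_option last (z w)"
        using fun_cong[OF lab, of a] by (simp add: child_labels_def w)
      have "\<exists>v. z u = Some v \<and> z w = Some (v @ [last c])" if "z w = Some c" for c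
        using partial_automorphism_preserves_parents[OF z, of u a c] that w by auto
      moreover have "\<exists>v. y u = Some v \<and> y w = Some (v @ [last c])" if "y w = Some c" for c
        using partial_automorphism_preserves_parents[OF y, of u a c] that w by auto
      ultimately show ?thesis
        using last uu by (cases "y w"; cases "z w") fastforce+
    qed
  qed
qed

lemma orbit_point_cyclic:
  assumes y: "y \<in> partial_automorphisms d n" and "cyclic_point y (u @ [a])"
  shows "iterate m y u = Some (orbit_point y u m)"
    and "\<exists>c. y (orbit_point y u m @ [c]) \<noteq> None"
    and "length (orbit_point y u m) = length u"
proof -
  obtain v where v: "iterate m y (u @ [a]) = Some v"
    using cyclic_point_iterate_defined[OF assms(2)] .
  obtain v' where "iterate (Suc m) y (u @ [a]) = Some v'"
    using cyclic_point_iterate_defined[OF assms(2)] .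
  then have yv: "y v = Some v'" using v by simp
  have len: "length v = Suc (length u)" using iterate_length[OF y v] by simp
  have u: "iterate m y u = Some (take (length u) v)"
    using iterate_take[OF y v, of "length u"] by simp
  then show "iterate m y u = Some (orbit_point y u m)" by (simp add: orbit_point_def)
  have "v = take (length u) v @ [last v]"
    using len by (metis append_butlast_last_id butlast_conv_take diff_Suc_1 length_0_conv nat.distinct(1))
  then have "v = orbit_point y u m @ [last v]"
    using u by (simp add: orbit_point_def)
  then have "y (orbit_point y u m @ [last v]) \<noteq> None" using yv by simp
  then show "\<exists>c. y (orbit_point y u m @ [c]) \<noteq> None" by blast
  show "length (orbit_point y u m) = length u" using u len by (simp add: orbit_point_def)
qed

text \<open>
  For a bottom vertex below \<open>u\<close> to be cyclic, every point of the orbit of \<open>u\<close> must keep at least one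
  child in the domain. Erasing the children of any one of the \<open>L + 1\<close> distinct points at times
  \<open>0\<close> to \<open>L\<close> yields a partial automorphism in which the erased place can still be located, as the only
  childless point of that orbit segment. The erased labels take at most \<open>(d + 1) ^ d\<close> values, so
  pairs of a map and a place inject into pairs of a map and a labelling.
\<close>

lemma long_period_cyclic_rare:
  fixes d n L a :: nat and u :: "nat list"
  defines "E \<equiv> {y \<in> partial_automorphisms d n. cyclic_point y (u @ [a]) \<and> \<not> returns_within L y u}"
  assumes u: "Suc (length u) = n"
  shows "(L + 1) * card E \<le> (d + 1) ^ d * card (partial_automorphisms d n)"
proof -
  let ?P = "partial_automorphisms d n"
  let ?C = "{0..<d} \<rightarrow>\<^sub>E insert None (Some ` {0..<d})"
  define \<phi> where "\<phi> = (\<lambda>(y, i). (remove_children (orbit_point y u i) y,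
      child_labels d y (orbit_point y u i)))"
  have EP: "y \<in> ?P" and cyc: "cyclic_point y (u @ [a])" and ret: "\<not> returns_within L y u"
    if "y \<in> E" for y
    using that by (auto simp: E_def)
  have "\<phi> ` (E \<times> {0..L}) \<subseteq> ?P \<times> ?C"
    using remove_children_partial_automorphism[OF EP] child_labels_in_PiE[OF EP]
      orbit_point_cyclic(3)[OF EP cyc] u
    unfolding \<phi>_def by (clarsimp simp del: PiE_iff insert_iff)
  moreover have "inj_on \<phi> (E \<times> {0..L})"
  proof (rule inj_onI, clarify)
    fix y i z k
    assume y: "y \<in> E" and z: "z \<in> E" and i: "i \<in> {0..L}" and k: "k \<in> {0..L}"
      and eq: "\<phi> (y, i) = \<phi> (z, k)"
    let ?yi = "orbit_point y u i" and ?zk = "orbit_point z u k"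
    have rem: "remove_children ?yi y = remove_children ?zk z"
      and lab: "child_labels d y ?yi = child_labels d z ?zk"
      using eq by (auto simp: \<phi>_def)
    \<comment> \<open>removal at the bottom does not disturb the orbit of \<open>u\<close>, so \<open>y\<close> and \<open>z\<close> share that orbit\<close>
    have "iterate m y u = iterate m (remove_children ?yi y) u" for m
      using iterate_remove_children[OF EP[OF y], of u ?yi]
        orbit_point_cyclic(3)[OF EP[OF y] cyc[OF y]] by simp
    moreover have "iterate m z u = iterate m (remove_children ?zk z) u" for m
      using iterate_remove_children[OF EP[OF z], of u ?zk]
        orbit_point_cyclic(3)[OF EP[OF z] cyc[OF z]] by simp
    ultimately have "iterate m y u = iterate m z u" for m
      unfolding rem by metis
    then have same: "orbit_point y u = orbit_point z u"
      by (simp only: orbit_point_def fun_eq_iff) simp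
    \<comment> \<open>otherwise the \<open>k\<close>-th orbit point has a child in the first reduced map but none in the second\<close>
    have "i = k"
    proof (rule ccontr)
      assume "i \<noteq> k"
      moreover have "orbit_point y u k \<noteq> ?yi"
      proof
        assume "orbit_point y u k = ?yi"
        then have "iterate k y u = Some ?yi" "iterate i y u = Some ?yi"
          using orbit_point_cyclic(1)[OF EP[OF y] cyc[OF y]] by metis+
        then show False
          using iterates_distinct[OF EP[OF y] ret[OF y]] i k \<open>i \<noteq> k\<close> by auto
      qed
      moreover obtain c where "y (orbit_point y u k @ [c]) \<noteq> None"
        using orbit_point_cyclic(2)[OF EP[OF y] cyc[OF y]] by blast
      ultimately have "remove_children ?yi y (?zk @ [c]) \<noteq> None"
        by (simp add: remove_children_def same)
      then show False unfolding rem by (simp add: remove_children_def)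
    qed
    moreover from this have "y = z"
      using partial_automorphism_eqI[OF EP[OF y] EP[OF z]] rem lab same by simp
    ultimately show "y = z \<and> i = k" by simp
  qed
  moreover have "finite ?C" by (intro finite_PiE) auto
  ultimately have le: "card (E \<times> {0..L}) \<le> card (?P \<times> ?C)"
    using finite_partial_automorphisms by (intro card_inj_on_le[of \<phi>]) auto
  have "card ?C = (d + 1) ^ d"
    by (simp add: card_PiE card_image)
  then show ?thesis using le unfolding card_cartesian_product by (simp add: mult.commute)
qed

section \<open>The probability that a bottom vertex is cyclic\<close>

text \<open>
  The parameter \<open>L\<close> separates short from long periods of the parent of \<open>x\<close>, and is free: it is chosen
  large first, and then \<open>n\<close> large.
\<close>

lemma cyclic_point_probability_bound:
  assumes d: "d \<ge> 2" and x: "x \<in> bottom_level d n" and n: "n \<ge> 1"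
  shows "real (card {y \<in> partial_automorphisms d n. cyclic_point y x})
    \<le> (4 ^ L * (3 / 4) ^ (n - 1) + real ((d + 1) ^ d) / real (L + 1))
        * real (card (partial_automorphisms d n))"
proof -
  let ?P = "partial_automorphisms d n"
  let ?N = "real (card ?P)"
  define u a where "u = take (n - 1) x" and "a = last x"
  have len: "length x = n" using x by (simp add: bottom_level_def)
  have xu: "x = u @ [a]"
    using len n by (metis a_def u_def append_butlast_last_id butlast_conv_take length_0_conv not_one_le_zero)
  have u: "Suc (length u) = n" using len n by (simp add: u_def)
  let ?S = "{y \<in> ?P. returns_within L y u}"
  let ?E = "{y \<in> ?P. cyclic_point y (u @ [a]) \<and> \<not> returns_within L y u}"
  have fin: "finite {y \<in> ?P. Q y}" for Q using finite_partial_automorphisms by simp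
  have "card {y \<in> ?P. cyclic_point y x} \<le> card (?S \<union> ?E)"
    using fin by (intro card_mono finite_UnI) (auto simp: xu)
  also have "\<dots> \<le> card ?S + card ?E" by (rule card_Un_le)
  finally have "real (card {y \<in> ?P. cyclic_point y x}) \<le> real (card ?S) + real (card ?E)"
    by linarith
  moreover have "real (card ?S) \<le> 4 ^ L * (3 / 4) ^ (n - 1) * ?N"
    using short_period_rare[OF d x, of "n - 1" L] by (simp add: u_def)
  moreover have "real ((L + 1) * card ?E) \<le> real ((d + 1) ^ d * card ?P)"
    using long_period_cyclic_rare[OF u, of L d a] by (simp only: of_nat_le_iff)
  then have "real (L + 1) * real (card ?E) \<le> real ((d + 1) ^ d) * ?N"
    by (simp only: of_nat_mult)
  then have "real (card ?E) \<le> real ((d + 1) ^ d) / real (L + 1) * ?N"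
    by (simp add: field_simps)
  ultimately show ?thesis by (simp add: distrib_right)
qed

lemma unary_words_eq:
  assumes "set v \<subseteq> {0..<1::nat}" "set w \<subseteq> {0..<1}" "length v = length w"
  shows "v = w"
proof (rule nth_equalityI)
  fix i assume "i < length v"
  then have "v ! i \<in> set v" "w ! i \<in> set w" using assms(3) by auto
  then show "v ! i = w ! i" using assms(1,2) by force
qed (fact assms(3))

text \<open>
  For \<open>d = 1\<close> there are no siblings to swap, and all periods are \<open>1\<close>. But the tree is a path, whose only
  partial automorphisms are the identities of its \<open>n + 1\<close> initial segments, and just one of these
  reaches the bottom.
\<close>

lemma cyclic_point_probability_bound_unary:
  assumes x: "x \<in> bottom_level 1 n"
  shows "(n + 1) * card {y \<in> partial_automorphisms 1 n. cyclic_point y x}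
    \<le> card (partial_automorphisms 1 n)"
proof -
  let ?P = "partial_automorphisms 1 n"
  define t where "t = (\<lambda>j w. if w \<in> tree_words 1 j then Some w else None)"
  have x': "length x = n" "set x \<subseteq> {0..<1}"
    using x by (auto simp: bottom_level_def mem_tree_words)
  have "{y \<in> ?P. cyclic_point y x} \<subseteq> {t n}"
  proof clarify
    fix y assume y: "y \<in> ?P" and "cyclic_point y x"
    then obtain x1 where x1: "y x = Some x1"
      using cyclic_point_iterate_defined[of y x 1] by auto
    have same: "w = w'" if "y w = Some w'" for w w'
      using unary_words_eq partial_automorphism_domD[OF y that]
        partial_automorphism_length[OF y that] by (auto simp: mem_tree_words)
    have "y w = t n w" for w
    proof (cases "w \<in> tree_words 1 n")
      case True
      then have "w = take (length w) x"
        using x' by (intro unary_words_eq) (auto simp: mem_tree_words dest: in_set_takeD)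
      then obtain w' where "y w = Some w'"
        using partial_automorphism_take[OF y x1, of "length w"] by auto
      then show ?thesis using same True by (auto simp: t_def)
    next
      case False
      then show ?thesis using partial_automorphism_domD[OF y, of w] by (cases "y w") (auto simp: t_def)
    qed
    then show "y = t n" by blast
  qed
  then have "card {y \<in> ?P. cyclic_point y x} \<le> 1"
    using card_mono[of "{t n}"] by simp
  then have "(n + 1) * card {y \<in> ?P. cyclic_point y x} \<le> (n + 1) * 1"
    by (rule mult_le_mono2)
  also have "\<dots> \<le> card ?P"
  proof -
    have "t j \<in> ?P" if "j \<le> n" for j
      unfolding partial_automorphism_iff
      using that by (auto simp: t_def mem_tree_words inj_on_def ran_def split: if_splits)
    moreover have "inj_on t {0..n}"
    proof
      fix j k assume "t j = t k"
      then have "replicate i 0 \<in> tree_words 1 j \<longleftrightarrow> replicate i 0 \<in> tree_words 1 k" for i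
        by (metis t_def option.distinct(1))
      moreover have "replicate i 0 \<in> tree_words 1 l \<longleftrightarrow> i \<le> l" for i l
        using set_replicate_conv_if[of i "0 :: nat"] by (simp add: mem_tree_words)
      ultimately have "i \<le> j \<longleftrightarrow> i \<le> k" for i by simp
      then show "j = k" by (meson le_antisym order_refl)
    qed
    ultimately have "card {0..n} \<le> card ?P"
      using finite_partial_automorphisms by (intro card_inj_on_le[of t]) auto
    then show ?thesis by simp
  qed
  finally show ?thesis .
qed

lemma cyclic_point_probability_vanishes:
  assumes d: "d \<ge> 1" and \<delta>: "\<delta> > 0"
  shows "\<forall>\<^sub>F n in sequentially. \<forall>x\<in>bottom_level d n.
    real (card {y \<in> partial_automorphisms d n. cyclic_point y x})
      \<le> \<delta> * real (card (partial_automorphisms d n))"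
proof (cases "d = 1")
  case True
  have "(\<lambda>n. 1 / real (n + 1)) \<longlonglongrightarrow> 0"
    using LIMSEQ_Suc[OF lim_const_over_n[of "1 :: real"]] by simp
  then have "\<forall>\<^sub>F n in sequentially. 1 / real (n + 1) < \<delta>"
    using \<delta> by (rule order_tendstoD(2))
  then show ?thesis
  proof eventually_elim
    case (elim n)
    show ?case
    proof
      fix x assume x: "x \<in> bottom_level d n"
      let ?c = "real (card {y \<in> partial_automorphisms d n. cyclic_point y x})"
      let ?N = "real (card (partial_automorphisms d n))"
      have "real ((n + 1) * card {y \<in> partial_automorphisms d n. cyclic_point y x}) \<le> ?N"
        using cyclic_point_probability_bound_unary[of x n] x unfolding True
        by (simp only: of_nat_le_iff)
      then have "real (n + 1) * ?c \<le> ?N" by (simp only: of_nat_mult)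
      then have "?c \<le> 1 / real (n + 1) * ?N" by (simp add: field_simps)
      also have "\<dots> \<le> \<delta> * ?N" using elim by (intro mult_right_mono) auto
      finally show "?c \<le> \<delta> * ?N" .
    qed
  qed
next
  case False
  then have d2: "d \<ge> 2" using d by simp
  have "(\<lambda>L. real ((d + 1) ^ d) / real (L + 1)) \<longlonglongrightarrow> 0"
    using LIMSEQ_Suc[OF lim_const_over_n[of "real ((d + 1) ^ d)"]] by simp
  then have "\<forall>\<^sub>F L in sequentially. real ((d + 1) ^ d) / real (L + 1) < \<delta> / 2"
    by (rule order_tendstoD(2)) (use \<delta> in simp)
  then obtain L where L: "real ((d + 1) ^ d) / real (L + 1) < \<delta> / 2"
    using eventually_happens'[OF sequentially_bot] by blast
  have "(\<lambda>n. 4 ^ L * (3 / 4 :: real) ^ (n - 1)) \<longlonglongrightarrow> 0"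
    by (rule LIMSEQ_imp_Suc) (simp add: tendsto_mult_right_zero LIMSEQ_realpow_zero)
  then have "\<forall>\<^sub>F n in sequentially. 4 ^ L * (3 / 4 :: real) ^ (n - 1) < \<delta> / 2"
    by (rule order_tendstoD(2)) (use \<delta> in simp)
  then show ?thesis
    using eventually_ge_at_top[of 1]
  proof eventually_elim
    case (elim n)
    show ?case
    proof
      fix x assume x: "x \<in> bottom_level d n"
      let ?N = "real (card (partial_automorphisms d n))"
      have "real (card {y \<in> partial_automorphisms d n. cyclic_point y x})
        \<le> (4 ^ L * (3 / 4) ^ (n - 1) + real ((d + 1) ^ d) / real (L + 1)) * ?N"
        using cyclic_point_probability_bound[OF d2 x] elim by blast
      also have "\<dots> \<le> \<delta> * ?N"
      proof (rule mult_right_mono)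
        show "4 ^ L * (3 / 4) ^ (n - 1) + real ((d + 1) ^ d) / real (L + 1) \<le> \<delta>"
          using elim(1) L by linarith
      qed simp
      finally show "real (card {y \<in> partial_automorphisms d n. cyclic_point y x}) \<le> \<delta> * ?N" .
    qed
  qed
qed

section \<open>Cyclic points and the eigenvalue zero\<close>

text \<open>
  A point moved by \<open>\<pi>\<close> stays moved along its whole \<open>\<pi>\<close>-orbit, so \<open>y\<close> follows \<open>\<pi>\<close> around a full cycle.
\<close>

lemma cyclic_pointI_permutation:
  assumes \<pi>: "\<pi> permutes I" and "finite I" and "\<pi> i \<noteq> i"
    and step: "\<And>k. k \<in> I \<Longrightarrow> \<pi> k \<noteq> k \<Longrightarrow> y (v k) = Some (v (\<pi> k))"
  shows "cyclic_point y (v i)"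
proof -
  have moved: "(\<pi> ^^ m) i \<in> I \<and> \<pi> ((\<pi> ^^ m) i) \<noteq> (\<pi> ^^ m) i" for m
  proof (induction m)
    case 0
    then show ?case using assms(3) \<pi> by (auto dest: permutes_not_in)
  next
    case (Suc m)
    then show ?case using permutes_in_image[OF \<pi>] permutes_inj[OF \<pi>] by (auto dest: injD)
  qed
  have iter: "iterate m y (v i) = Some (v ((\<pi> ^^ m) i))" for m
    by (induction m) (use step moved in auto)
  obtain m where "\<pi> ^^ m = id" "m > 0"
    using permutation_is_nilpotent[of \<pi>] \<pi> assms(2) permutation_permutes by blast
  then show ?thesis
    using iter[of m] by (auto simp: cyclic_point_def intro!: exI[of _ m])
qed

text \<open>
  In the permutation expansion of \<open>det (X - M)\<close>, a nonzero summand comes from a \<open>\<pi>\<close> that agrees with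
  \<open>y\<close> wherever it moves an index. Such a \<open>\<pi>\<close> fixes every index with a noncyclic point, and there the
  diagonal entry of \<open>M\<close> vanishes, so each of these indices contributes a factor \<open>X\<close>.
\<close>

lemma monom_dvd_char_poly:
  fixes M :: "'a :: comm_ring_1 mat" and y :: "'b \<rightharpoonup> 'b"
  assumes M: "M \<in> carrier_mat N N"
    and entries: "\<And>i j. i < N \<Longrightarrow> j < N \<Longrightarrow> M $$ (i, j) \<noteq> 0 \<Longrightarrow> y (v i) = Some (v j)"
  shows "monom 1 (card {i\<in>{0..<N}. \<not> cyclic_point y (v i)}) dvd char_poly M"
proof -
  let ?Z = "{i\<in>{0..<N}. \<not> cyclic_point y (v i)}"
  let ?X = "char_poly_matrix M"
  have X: "?X $$ (i, j) = (if i = j then [:0, 1:] else 0) + [:- (M $$ (i, j)):]"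
    if "i < N" "j < N" for i j
    using M that by (simp add: char_poly_matrix_def)
  have "monom 1 (card ?Z) dvd (\<Prod>i = 0..<N. ?X $$ (i, \<pi> i))" if \<pi>: "\<pi> permutes {0..<N}" for \<pi>
  proof (cases "\<forall>i\<in>{0..<N}. ?X $$ (i, \<pi> i) \<noteq> 0")
    case False
    then have "(\<Prod>i = 0..<N. ?X $$ (i, \<pi> i)) = 0" by (intro prod_zero) auto
    then show ?thesis by simp
  next
    case True
    have \<pi>I: "\<pi> i < N" if "i < N" for i using permutes_in_image[OF \<pi>, of i] that by simp
    have step: "y (v k) = Some (v (\<pi> k))" if "k \<in> {0..<N}" "\<pi> k \<noteq> k" for k
      using True that X[of k "\<pi> k"] \<pi>I[of k] by (intro entries) auto
    have diag: "?X $$ (i, \<pi> i) = [:0, 1:]" if i: "i \<in> ?Z" for i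
    proof -
      have "\<pi> i = i"
        using cyclic_pointI_permutation[where v = v and y = y, OF \<pi> _ _ step] i by blast
      moreover have "M $$ (i, i) = 0"
      proof (rule ccontr)
        assume "M $$ (i, i) \<noteq> 0"
        then have "iterate 1 y (v i) = Some (v i)" using entries[of i i] i by simp
        then show False using i by (auto simp: cyclic_point_def)
      qed
      ultimately show ?thesis using X[of i i] i by simp
    qed
    have "monom 1 (card ?Z) = (\<Prod>i\<in>?Z. ?X $$ (i, \<pi> i))"
      using diag by (simp add: monom_altdef)
    also have "\<dots> dvd (\<Prod>i = 0..<N. ?X $$ (i, \<pi> i))"
      by (intro prod_dvd_prod_subset) auto
    finally show ?thesis .
  qed
  then show ?thesis
    unfolding char_poly_def det_def'[OF char_poly_matrix_closed[OF M]]
    by (intro dvd_sum dvd_mult) auto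
qed

lemma pmf_zero_eigenvalue_ge:
  assumes d: "d \<ge> 1"
  shows "1 - pmf (eigenvalue_distribution d n v y) 0
    \<le> real (card {i\<in>{0..<d ^ n}. cyclic_point y (v i)}) / real (d ^ n)"
proof -
  let ?N = "d ^ n" and ?A = "action_matrix d n v y"
  let ?C = "{i\<in>{0..<?N}. cyclic_point y (v i)}" and ?Z = "{i\<in>{0..<?N}. \<not> cyclic_point y (v i)}"
  have A: "?A \<in> carrier_mat ?N ?N" by (simp add: action_matrix_def)
  have ne: "char_poly ?A \<noteq> 0" using degree_monic_char_poly[OF A] by auto
  have "monom 1 (card ?Z) dvd char_poly ?A"
    using A by (rule monom_dvd_char_poly) (simp add: action_matrix_def split: if_splits)
  then have "card ?Z \<le> count (proots (char_poly ?A)) 0"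
    using ne by (simp add: monom_1_dvd_iff)
  moreover have "card ?C + card ?Z = card (?C \<union> ?Z)"
    by (intro card_Un_disjoint[symmetric]) auto
  moreover have "?C \<union> ?Z = {0..<?N}" by auto
  then have "card (?C \<union> ?Z) = ?N" by simp
  ultimately have "?N \<le> card ?C + count (proots (char_poly ?A)) 0" by linarith
  then have "real ?N - real (count (proots (char_poly ?A)) 0) \<le> real (card ?C)" by linarith
  then have "(real ?N - real (count (proots (char_poly ?A)) 0)) / real ?N \<le> real (card ?C) / real ?N"
    by (rule divide_right_mono) simp
  then show ?thesis
    using d by (simp add: pmf_eigenvalue_distribution[OF d] diff_divide_distrib)
qed

text \<open>
  The integrand minus \<open>f 0\<close> vanishes at \<open>0\<close> and is bounded by \<open>2 * K\<close> elsewhere, also outside the disc,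
  where the indicator replaces \<open>f\<close> by \<open>0\<close>. So the estimate is independent of where the nonzero
  eigenvalues are.
\<close>

lemma integral_deviation_le:
  fixes \<Xi> :: "complex pmf" and f :: "complex \<Rightarrow> complex"
  assumes fin: "finite (set_pmf \<Xi>)" and K: "\<And>z. z \<in> cball 0 1 \<Longrightarrow> cmod (f z) \<le> K"
  shows "cmod ((LINT x:cball 0 1|\<Xi>. f x) - f 0) \<le> 2 * K * (1 - pmf \<Xi> 0)"
proof -
  let ?g = "\<lambda>x. indicator (cball 0 1) x *\<^sub>R f x - f 0"
  have K0: "cmod (f 0) \<le> K" using K[of 0] by simp
  note int = integrable_measure_pmf_finite[OF fin]
  have "(LINT x:cball 0 1|\<Xi>. f x) - f 0 = (LINT x|\<Xi>. ?g x)"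
    unfolding set_lebesgue_integral_def
    by (subst Bochner_Integration.integral_diff) (auto intro: int)
  also have "cmod \<dots> \<le> (LINT x|\<Xi>. cmod (?g x))"
    by (rule integral_norm_bound)
  also have "\<dots> \<le> (LINT x|\<Xi>. 2 * K * indicator (- {0}) x)"
  proof (rule integral_mono[OF int int])
    fix x :: complex
    have "cmod (?g x) \<le> cmod (indicator (cball 0 1) x *\<^sub>R f x) + cmod (f 0)"
      by (rule norm_triangle_ineq4)
    also have "\<dots> \<le> K + K"
      using K[of x] K0 order_trans[OF norm_ge_zero K0] by (intro add_mono) (auto simp: indicator_def)
    finally show "cmod (?g x) \<le> 2 * K * indicator (- {0}) x"
      by (cases "x = 0") auto
  qed
  also have "\<dots> = 2 * K * measure_pmf.prob \<Xi> (- {0})" by simp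
  also have "measure_pmf.prob \<Xi> (- {0}) = 1 - pmf \<Xi> 0"
    using measure_pmf.prob_compl[of "{0}" \<Xi>] by (simp add: measure_pmf_single Compl_eq_Diff_UNIV)
  finally show ?thesis .
qed

lemma finite_set_pmf_eigenvalue_distribution:
  assumes "d \<ge> 1"
  shows "finite (set_pmf (eigenvalue_distribution d n v y))"
proof -
  have "proots (char_poly (action_matrix d n v y)) \<noteq> {#}"
    using size_eigenvalues[of d n v y] assms by auto
  then show ?thesis by (simp add: eigenvalue_distribution_def)
qed

section \<open>Convergence in probability\<close>

lemma sum_cyclic_counts:
  fixes v :: "nat \<Rightarrow> 'a" and P :: "('a \<rightharpoonup> 'a) set"
  assumes \<delta>: "\<And>i. i < N \<Longrightarrow> real (card {y \<in> P. cyclic_point y (v i)}) \<le> \<delta> * real (card P)"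
    and P: "finite P"
  shows "(\<Sum>y\<in>P. real (card {i\<in>{0..<N}. cyclic_point y (v i)})) \<le> \<delta> * real N * real (card P)"
proof -
  have "(\<Sum>y\<in>P. real (card {i\<in>{0..<N}. cyclic_point y (v i)}))
      = (\<Sum>y\<in>P. \<Sum>i\<in>{0..<N}. of_bool (cyclic_point y (v i)))"
    by (simp add: of_bool_def sum.If_cases Int_def)
  also have "\<dots> = (\<Sum>i\<in>{0..<N}. \<Sum>y\<in>P. of_bool (cyclic_point y (v i)))"
    by (rule sum.swap)
  also have "\<dots> = (\<Sum>i\<in>{0..<N}. real (card {y \<in> P. cyclic_point y (v i)}))"
    using P by (simp add: of_bool_def sum.If_cases Int_def)
  also have "\<dots> \<le> (\<Sum>i\<in>{0..<N}. \<delta> * real (card P))"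
    using \<delta> by (intro sum_mono) auto
  finally show ?thesis by (simp add: mult_ac)
qed

lemma markov_counting:
  fixes c :: "'a \<Rightarrow> real"
  assumes P: "finite P" and c: "\<And>y. y \<in> P \<Longrightarrow> 0 \<le> c y" and S: "S \<subseteq> P"
    and big: "\<And>y. y \<in> S \<Longrightarrow> t \<le> c y"
  shows "t * real (card S) \<le> sum c P"
proof -
  have "t * real (card S) = (\<Sum>y\<in>S. t)" by simp
  also have "\<dots> \<le> sum c S" using big by (intro sum_mono)
  also have "\<dots> \<le> sum c P" using P S c by (intro sum_mono2) auto
  finally show ?thesis .
qed

theorem theorem3p1:
  fixes d :: nat
    and v :: "nat \<Rightarrow> nat \<Rightarrow> nat list"
    and f :: "complex \<Rightarrow> complex"
  assumes "d \<ge> 1"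
    and "\<And>n. n \<ge> 1 \<Longrightarrow> bij_betw (v n) {0..<d ^ n} (bottom_level d n)"
    and "continuous_on (cball 0 1) f"
  shows "\<forall>\<epsilon>>0.
    (\<lambda>n. measure_pmf.prob (pmf_of_set (partial_automorphisms d n))
       {y. cmod ((LINT x:cball 0 1|eigenvalue_distribution d n (v n) y. f x) - f 0) > \<epsilon>})
    \<longlonglongrightarrow> 0"
proof (intro allI impI)
  fix \<epsilon> :: real assume \<epsilon>: "\<epsilon> > 0"
  let ?P = "partial_automorphisms d"
  let ?dev = "\<lambda>n y. cmod ((LINT x:cball 0 1|eigenvalue_distribution d n (v n) y. f x) - f 0)"
  let ?bad = "\<lambda>n. {y. ?dev n y > \<epsilon>}"
  let ?cyc = "\<lambda>n y. real (card {i\<in>{0..<d ^ n}. cyclic_point y (v n i)})"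
  have "bounded (f ` cball 0 1)"
    using assms(3) by (intro compact_imp_bounded compact_continuous_image) auto
  then obtain K where K: "K > 0" "\<And>z. z \<in> cball 0 1 \<Longrightarrow> cmod (f z) \<le> K"
    by (auto simp: bounded_pos)
  have dev: "?dev n y \<le> 2 * K * (?cyc n y / real (d ^ n))" for n y
  proof -
    have "?dev n y \<le> 2 * K * (1 - pmf (eigenvalue_distribution d n (v n) y) 0)"
      using finite_set_pmf_eigenvalue_distribution[OF assms(1)] K(2) by (rule integral_deviation_le)
    also have "\<dots> \<le> 2 * K * (?cyc n y / real (d ^ n))"
      using pmf_zero_eigenvalue_ge[OF assms(1)] K(1) by (intro mult_left_mono) auto
    finally show ?thesis .
  qed
  show "(\<lambda>n. measure_pmf.prob (pmf_of_set (?P n)) (?bad n)) \<longlonglongrightarrow> 0"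
  proof (rule LIMSEQ_I)
    fix r :: real assume r: "r > 0"
    \<comment> \<open>the factor 4 leaves a strict inequality after the factor \<open>2 * K\<close> of \<open>dev\<close>\<close>
    define \<delta> where "\<delta> = \<epsilon> * r / (4 * K)"
    have \<delta>: "\<delta> > 0" using \<epsilon> r K(1) by (simp add: \<delta>_def)
    have "\<forall>\<^sub>F n in sequentially.
        norm (measure_pmf.prob (pmf_of_set (?P n)) (?bad n) - 0) < r"
      using cyclic_point_probability_vanishes[OF assms(1) \<delta>] eventually_ge_at_top[of 1]
    proof eventually_elim
      case (elim n)
      let ?N = "real (d ^ n)" and ?c = "real (card (?P n))" and ?b = "real (card (?P n \<inter> ?bad n))"
      have N: "?N > 0" using assms(1) by simp
      have c: "?c > 0"
        using partial_automorphisms_nonempty[of d n] finite_partial_automorphisms[of d n]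
        by (simp add: card_gt_0_iff)
      have "\<epsilon> / (2 * K) * ?N * ?b \<le> (\<Sum>y\<in>?P n. ?cyc n y)"
      proof (rule markov_counting[OF finite_partial_automorphisms])
        fix y assume "y \<in> ?P n \<inter> ?bad n"
        then have "\<epsilon> \<le> 2 * K * (?cyc n y / ?N)" using dev[of n y] by simp
        then show "\<epsilon> / (2 * K) * ?N \<le> ?cyc n y" using K(1) N by (simp add: field_simps)
      qed auto
      also have "\<dots> \<le> \<delta> * ?N * ?c"
        using elim assms(2)[of n]
        by (intro sum_cyclic_counts finite_partial_automorphisms) (auto simp: bij_betw_def simp del: of_nat_power)
      finally have "(\<epsilon> / (2 * K) * ?N) * ?b \<le> (\<epsilon> / (2 * K) * ?N) * (r / 2 * ?c)"
        by (simp add: \<delta>_def algebra_simps)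
      moreover have "\<epsilon> / (2 * K) * ?N > 0" using \<epsilon> K(1) N by simp
      ultimately have "?b \<le> r / 2 * ?c" by (simp only: mult_le_cancel_left_pos)
      also have "\<dots> < r * ?c" using r c by simp
      finally have "?b / ?c < r" using c by (simp add: pos_divide_less_eq)
      moreover have "measure_pmf.prob (pmf_of_set (?P n)) (?bad n) = ?b / ?c"
        using partial_automorphisms_nonempty finite_partial_automorphisms
        by (rule measure_pmf_of_set)
      ultimately show ?case by simp
    qed
    then show "\<exists>n0. \<forall>n\<ge>n0. norm (measure_pmf.prob (pmf_of_set (?P n)) (?bad n) - 0) < r"
      by (simp add: eventually_sequentially)
  qed
qed

end
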